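(* Let $G$ be a connected non-bipartite graph and $\Gamma=(G,\sigma)$ a signed graph on $G$. Then $\Gamma\in\mathbb{NFS}_1(G)$ if and only if $\Gamma$ is switching isomorphic to a signed graph $\Gamma^a$ or to a signed graph $\Gamma^b$ whose adjacency matrix has, respectively, the form $$A(\Gamma^a)=\begin{pmatrix} B & X \\ X & -B \end{pmatrix},\qquad A(\Gamma^b)=\begin{pmatrix} B & Y \\ -Y & -B \end{pmatrix},$$ where $B$, $X$, $Y$ are square matrices of the same size with entries in $\{0,1,-1\}$, $B=B^\top$ has zero diagonal, $X=X^\top$, and $Y=-Y^\top$.
   Context: Graphs are finite and simple. A signed graph $\Gamma=(G,\sigma)$ on $G$ is $G$ with a function $\sigma:E(G)\to\{+1,-1\}$; its adjacency matrix has $(u,v)$-entry $\sigma(uv)$ if $uv\in E(G)$ and $0$ otherwise. Switching $\Gamma$ with respect to $U\subseteq V(G)$ reverses the signs of all edges between $U$ and $V(G)\setminus U$. $\Gamma\simeq\Gamma'$ (switching isomorphic) means $\Gamma$ is isomorphic, by a sign-preserving graph isomorphism, to a switching of $\Gamma'$. $\Gamma$ is sign-symmetric if $\Gamma\simeq-\Gamma=(G,-\sigma)$. The sign of a cycle is the product of the signs of its edges. A weak automorphism of $\Gamma$ is a $\varphi\in Aut(G)$ with $\sigma(\varphi(C))=-\sigma(C)$ for every odd cycle $C$ of $G$ and $\sigma(\varphi(C))=\sigma(C)$ for every even cycle $C$. It is principal (a PWA) if it has the smallest order among all weak automorphisms of $\Gamma$. $\mathbb{S}_1(G)$ is the set of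 sign-symmetric signed graphs on $G$ having a principal weak automorphism of order $2$. For such a $\varphi$ put $F=\{v\in V(G)\mid\varphi(v)=v\}$. $\mathbb{NFS}_1(G)$ is the set of $\Gamma\in\mathbb{S}_1(G)$ with $F=\emptyset$, i.e. having a principal weak automorphism of order $2$ without fixed vertices. *)

theory Defs
  imports
    "HOL-Combinatorics.Permutations"
    "HOL-Library.FuncSet"
    "Jordan_Normal_Form.Matrix"
begin

record 'a graph =
  verts :: "'a set"
  edges :: "'a set set"

definition simple_graph :: "'a graph \<Rightarrow> bool" where
  "simple_graph G \<longleftrightarrow> finite (verts G) \<and> (\<forall>e\<in>edges G. e \<subseteq> verts G \<and> card e = 2)"

definition connected_graph :: "'a graph \<Rightarrow> bool" where
  "connected_graph G \<longleftrightarrow> verts G \<noteq> {} \<and>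
     (\<forall>u\<in>verts G. \<forall>v\<in>verts G. (u, v) \<in> {(x, y). {x, y} \<in> edges G}\<^sup>*)"

definition bipartite_graph :: "'a graph \<Rightarrow> bool" where
  "bipartite_graph G \<longleftrightarrow>
     (\<exists>U \<subseteq> verts G. \<forall>e\<in>edges G. \<exists>u\<in>U. \<exists>v\<in>verts G - U. e = {u, v})"

definition graph_isomorphism :: "('a \<Rightarrow> 'b) \<Rightarrow> 'a graph \<Rightarrow> 'b graph \<Rightarrow> bool" where
  "graph_isomorphism f G H \<longleftrightarrow> bij_betw f (verts G) (verts H) \<and>
     (\<forall>u\<in>verts G. \<forall>v\<in>verts G. {u, v} \<in> edges G \<longleftrightarrow> {f u, f v} \<in> edges H)"

text \<open>Automorphisms are represented by functions that are the identity outside the vertex set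
  (\<open>permutes\<close>), so that each automorphism has exactly one representative.\<close>

definition automorphisms :: "'a graph \<Rightarrow> ('a \<Rightarrow> 'a) set" where
  "automorphisms G = {\<phi>. \<phi> permutes verts G \<and> graph_isomorphism \<phi> G G}"

definition aut_order :: "('a \<Rightarrow> 'a) \<Rightarrow> nat" where
  "aut_order \<phi> = (LEAST k. 0 < k \<and> \<phi> ^^ k = id)"

text \<open>A cycle is given by the list of its successive vertices, the last one being adjacent to
  the first; its length is the number of its vertices, equivalently of its edges.\<close>

definition cycle_edge :: "'a list \<Rightarrow> nat \<Rightarrow> 'a set" where
  "cycle_edge c i = {c ! i, c ! (Suc i mod length c)}"

definition is_cycle :: "'a graph \<Rightarrow> 'a list \<Rightarrow> bool" where
  "is_cycle G c \<longleftrightarrow> 3 \<le> length c \<and> distinct c \<and> set c \<subseteq> verts G \<and>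
     (\<forall>i<length c. cycle_edge c i \<in> edges G)"

text \<open>A signed graph is a pair \<open>(G, \<sigma>)\<close>; the values of \<open>\<sigma>\<close> on sets that are not edges of \<open>G\<close>
  are irrelevant.\<close>

type_synonym 'a signed_graph = "'a graph \<times> ('a set \<Rightarrow> int)"

definition signed_graph :: "'a signed_graph \<Rightarrow> bool" where
  "signed_graph \<Gamma> \<longleftrightarrow> simple_graph (fst \<Gamma>) \<and> snd \<Gamma> \<in> edges (fst \<Gamma>) \<rightarrow> {1, -1}"

definition negate :: "'a signed_graph \<Rightarrow> 'a signed_graph" where
  "negate \<Gamma> = (fst \<Gamma>, \<lambda>e. - snd \<Gamma> e)"

definition switch :: "'a set \<Rightarrow> 'a signed_graph \<Rightarrow> 'a signed_graph" where
  "switch U \<Gamma> = (fst \<Gamma>, \<lambda>e. if e \<inter> U \<noteq> {} \<and> e \<inter> (verts (fst \<Gamma>) - U) \<noteq> {}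
     then - snd \<Gamma> e else snd \<Gamma> e)"

definition signed_isomorphism :: "('a \<Rightarrow> 'b) \<Rightarrow> 'a signed_graph \<Rightarrow> 'b signed_graph \<Rightarrow> bool" where
  "signed_isomorphism f \<Gamma> \<Gamma>' \<longleftrightarrow> graph_isomorphism f (fst \<Gamma>) (fst \<Gamma>') \<and>
     (\<forall>e\<in>edges (fst \<Gamma>). snd \<Gamma>' (f ` e) = snd \<Gamma> e)"

definition switching_isomorphic :: "'a signed_graph \<Rightarrow> 'b signed_graph \<Rightarrow> bool"
    (infix "\<simeq>\<^sub>s" 50) where
  "\<Gamma> \<simeq>\<^sub>s \<Gamma>' \<longleftrightarrow> (\<exists>U \<subseteq> verts (fst \<Gamma>'). \<exists>f. signed_isomorphism f \<Gamma> (switch U \<Gamma>'))"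

definition sign_symmetric :: "'a signed_graph \<Rightarrow> bool" where
  "sign_symmetric \<Gamma> \<longleftrightarrow> \<Gamma> \<simeq>\<^sub>s negate \<Gamma>"

definition cycle_sign :: "'a signed_graph \<Rightarrow> 'a list \<Rightarrow> int" where
  "cycle_sign \<Gamma> c = (\<Prod>i<length c. snd \<Gamma> (cycle_edge c i))"

definition weak_automorphism :: "'a signed_graph \<Rightarrow> ('a \<Rightarrow> 'a) \<Rightarrow> bool" where
  "weak_automorphism \<Gamma> \<phi> \<longleftrightarrow> \<phi> \<in> automorphisms (fst \<Gamma>) \<and>
     (\<forall>c. is_cycle (fst \<Gamma>) c \<longrightarrow>
        (odd (length c) \<longrightarrow> cycle_sign \<Gamma> (map \<phi> c) = - cycle_sign \<Gamma> c) \<and>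
        (even (length c) \<longrightarrow> cycle_sign \<Gamma> (map \<phi> c) = cycle_sign \<Gamma> c))"

definition principal_weak_automorphism :: "'a signed_graph \<Rightarrow> ('a \<Rightarrow> 'a) \<Rightarrow> bool" where
  "principal_weak_automorphism \<Gamma> \<phi> \<longleftrightarrow> weak_automorphism \<Gamma> \<phi> \<and>
     (\<forall>\<psi>. weak_automorphism \<Gamma> \<psi> \<longrightarrow> aut_order \<phi> \<le> aut_order \<psi>)"

definition fixed_verts :: "'a graph \<Rightarrow> ('a \<Rightarrow> 'a) \<Rightarrow> 'a set" where
  "fixed_verts G \<phi> = {v \<in> verts G. \<phi> v = v}"

definition S1 :: "'a graph \<Rightarrow> 'a signed_graph set" where
  "S1 G = {\<Gamma>. signed_graph \<Gamma> \<and> fst \<Gamma> = G \<and> sign_symmetric \<Gamma> \<and>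
     (\<exists>\<phi>. principal_weak_automorphism \<Gamma> \<phi> \<and> aut_order \<phi> = 2)}"

definition NFS1 :: "'a graph \<Rightarrow> 'a signed_graph set" where
  "NFS1 G = {\<Gamma> \<in> S1 G. \<exists>\<phi>. principal_weak_automorphism \<Gamma> \<phi> \<and> aut_order \<phi> = 2 \<and>
     fixed_verts G \<phi> = {}}"

text \<open>An adjacency matrix depends on an enumeration of the vertices.\<close>

definition vertex_enumeration :: "'a graph \<Rightarrow> 'a list \<Rightarrow> bool" where
  "vertex_enumeration G vs \<longleftrightarrow> distinct vs \<and> set vs = verts G"

definition adjacency_matrix :: "'a signed_graph \<Rightarrow> 'a list \<Rightarrow> int mat" where
  "adjacency_matrix \<Gamma> vs = mat (length vs) (length vs) (\<lambda>(i, j).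
     if {vs ! i, vs ! j} \<in> edges (fst \<Gamma>) then snd \<Gamma> {vs ! i, vs ! j} else 0)"

definition has_form_a :: "'a signed_graph \<Rightarrow> bool" where
  "has_form_a \<Gamma> \<longleftrightarrow> (\<exists>vs n B X. vertex_enumeration (fst \<Gamma>) vs \<and>
     B \<in> carrier_mat n n \<and> X \<in> carrier_mat n n \<and>
     elements_mat B \<subseteq> {0, 1, -1} \<and> elements_mat X \<subseteq> {0, 1, -1} \<and>
     B = transpose_mat B \<and> (\<forall>i<n. B $$ (i, i) = 0) \<and> X = transpose_mat X \<and>
     adjacency_matrix \<Gamma> vs = four_block_mat B X X (- B))"

definition has_form_b :: "'a signed_graph \<Rightarrow> bool" where
  "has_form_b \<Gamma> \<longleftrightarrow> (\<exists>vs n B Y. vertex_enumeration (fst \<Gamma>) vs \<and>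
     B \<in> carrier_mat n n \<and> Y \<in> carrier_mat n n \<and>
     elements_mat B \<subseteq> {0, 1, -1} \<and> elements_mat Y \<subseteq> {0, 1, -1} \<and>
     B = transpose_mat B \<and> (\<forall>i<n. B $$ (i, i) = 0) \<and> Y = - transpose_mat Y \<and>
     adjacency_matrix \<Gamma> vs = four_block_mat B Y (- Y) (- B))"

end

(* Since G is connected, a signing all of whose cycles are positive is a coboundary
   s(u) s(v) of a vertex signing s.  Applied to the signing -sigma(e) sigma(phi(e)), this turns
   a weak automorphism phi into a relation sigma(phi(u) phi(v)) = -s(u) s(v) sigma(uv); applied to
   the all-negative signing it produces an odd cycle in a non-bipartite graph, so that the identity
   is not a weak automorphism.  If phi is a fixed-point-free involution, using the relation twice
   shows that s(v) s(phi(v)) is constant.  If the constant is -1, ordering the vertices with s = 1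
   before their images gives the block form with X.  If it is 1, a switching that makes s identically
   1 gives the form with Y.  Conversely, exchanging the two halves of a block form is such an
   involution, with s = 1 on the first half and s = -1 (for X) or s = 1 (for Y) on the second. *)

theory Submission
  imports Defs "HOL-Combinatorics.Cycles"
begin

section \<open>Signs of walks, closed walks and coboundary signings\<close>

section \<open>Balance\<close>

fun walk_sign :: "('a set \<Rightarrow> int) \<Rightarrow> 'a list \<Rightarrow> int" where
  "walk_sign \<tau> (x # y # xs) = \<tau> {x, y} * walk_sign \<tau> (y # xs)"
| "walk_sign \<tau> _ = 1"

text \<open>The cut vertex \<open>y\<close> ends the first walk and starts the second, so every edge
  is counted exactly once.\<close>

lemma walk_sign_append: "walk_sign \<tau> (xs @ y # ys) = walk_sign \<tau> (xs @ [y]) * walk_sign \<tau> (y # ys)"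
proof (induction xs rule: induct_list012)
  case (2 x)
  then show ?case by (cases ys) auto
next
  case (3 x x' xs)
  then show ?case by simp
qed (cases ys; simp)

lemma walk_sign_rev: "walk_sign \<tau> (rev xs) = walk_sign \<tau> xs"
proof (induction xs rule: induct_list012)
  case (3 x y xs)
  then show ?case using walk_sign_append[of \<tau> "rev xs" y "[x]"] by (simp add: insert_commute)
qed auto

lemma walk_sign_conv_prod:
  "xs \<noteq> [] \<Longrightarrow> walk_sign \<tau> xs = (\<Prod>i<length xs - 1. \<tau> {xs ! i, xs ! Suc i})"
proof (induction xs rule: induct_list012)
  case (3 x y xs)
  then show ?case by (simp add: prod.lessThan_Suc_shift del: prod.lessThan_Suc)
qed auto

text \<open>Repeating the head at the end replaces the index modulo the length by a plain successor.
  A cycle thereby becomes a closed walk, to which \<open>walk_sign\<close> applies.\<close>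

lemma cycle_edge_conv_nth:
  assumes "i < length c"
  shows "cycle_edge c i = {(c @ [hd c]) ! i, (c @ [hd c]) ! Suc i}"
proof (cases "Suc i < length c")
  case False
  with assms have "Suc i = length c" by simp
  with assms show ?thesis
    by (cases c) (auto simp: cycle_edge_def nth_append nth_Cons' hd_conv_nth)
qed (use assms in \<open>auto simp: cycle_edge_def nth_append\<close>)

lemma cycle_sign_conv_walk_sign:
  assumes "c \<noteq> []"
  shows "cycle_sign \<Gamma> c = walk_sign (snd \<Gamma>) (c @ [hd c])"
  using assms by (simp add: cycle_sign_def walk_sign_conv_prod cycle_edge_conv_nth)

text \<open>Only consecutive adjacency is demanded, so one-vertex lists are walks; in a simple
  graph, membership in the vertex set follows from lying on an edge.\<close>

abbreviation walk :: "'a graph \<Rightarrow> 'a list \<Rightarrow> bool" where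
  "walk G \<equiv> successively (\<lambda>u v. {u, v} \<in> edges G)"

lemma simple_graph_edgeD:
  assumes "simple_graph G" and "{u, v} \<in> edges G"
  shows "u \<in> verts G" and "v \<in> verts G" and "u \<noteq> v"
  using assms unfolding simple_graph_def by fastforce+

lemma simple_graph_edgeE:
  assumes "simple_graph G" and "e \<in> edges G"
  obtains u v where "e = {u, v}" and "u \<in> verts G" and "v \<in> verts G" and "u \<noteq> v"
proof -
  have "e \<subseteq> verts G" "card e = 2" using assms by (auto simp: simple_graph_def)
  then show thesis using that by (auto simp: card_2_iff)
qed

lemma is_cycle_closed_walk:
  assumes G: "simple_graph G" and w: "walk G (c @ [hd c])" and c: "distinct c" "3 \<le> length c"
  shows "is_cycle G c"
proof -
  have e: "cycle_edge c i \<in> edges G" if "i < length c" for i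
    using w that unfolding cycle_edge_conv_nth[OF that] successively_conv_nth by simp
  have "c ! i \<in> verts G" if "i < length c" for i
    using e[OF that] G simple_graph_edgeD(1) unfolding cycle_edge_def by fast
  then have "set c \<subseteq> verts G" by (auto simp: in_set_conv_nth)
  with e c show ?thesis by (simp add: is_cycle_def)
qed

text \<open>Induction on the number of inner vertices: at a repeated vertex a closed walk splits
  into two shorter closed walks whose signs multiply, and without repetition it is a cycle or
  degenerate.\<close>

lemma closed_walk_sign:
  assumes G: "simple_graph G" and \<tau>: "\<tau> \<in> edges G \<rightarrow> {1, -1}"
    and cyc: "\<And>c. is_cycle G c \<Longrightarrow> cycle_sign (G, \<tau>) c = 1"
    and "walk G (x # xs @ [x])"
  shows "walk_sign \<tau> (x # xs @ [x]) = 1"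
  using assms(4)
proof (induction "length xs" arbitrary: x xs rule: less_induct)
  case less
  show ?case
  proof (cases "distinct (x # xs)")
    case True
    \<comment> \<open>With no inner vertex the walk would be a loop, which a simple graph excludes;
      with one it runs along an edge and back, and the sign is squared. Only from two on is it a
      cycle.\<close>
    consider "xs = []" | y where "xs = [y]" | "2 \<le> length xs"
      by (cases xs; cases "tl xs"; fastforce)
    then show ?thesis
    proof cases
      case 1
      then show ?thesis using less.prems simple_graph_edgeD(3)[OF G] by force
    next
      case 2
      then show ?thesis using less.prems \<tau> by (auto simp: insert_commute Pi_iff)
    next
      case 3
      then have "is_cycle G (x # xs)"
        using is_cycle_closed_walk[OF G, of "x # xs"] less.prems True by simp
      then show ?thesis using cyc[of "x # xs"] by (simp add: cycle_sign_conv_walk_sign)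
    qed
  next
    case False
    then obtain as bs cs y where eq: "x # xs = as @ [y] @ bs @ [y] @ cs"
      using not_distinct_decomp by blast
    show ?thesis
    \<comment> \<open>If \<open>as\<close> is empty, the repeated vertex is the base point and the
      walk splits there; otherwise the closed part \<open>y # bs @ [y]\<close> is cut out and what
      remains is still based at \<open>x\<close>.\<close>
    proof (cases as)
      case Nil
      then have xs: "xs = bs @ x # cs" and [simp]: "y = x" using eq by auto
      have "walk G (x # bs @ [x])" "walk G (x # cs @ [x])"
        using less.prems by (auto simp: xs successively_append_iff successively_Cons hd_append split: if_splits)
      then have "walk_sign \<tau> (x # bs @ [x]) = 1" "walk_sign \<tau> (x # cs @ [x]) = 1"
        using less.hyps by (auto simp: xs)
      then show ?thesis using walk_sign_append[of \<tau> "x # bs" x "cs @ [x]"] by (simp add: xs)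
    next
      case (Cons x' as')
      then have xs: "xs = as' @ y # bs @ y # cs" using eq by auto
      have "walk G (y # bs @ [y])" "walk G (x # (as' @ y # cs) @ [x])"
        using less.prems by (auto simp: xs successively_append_iff successively_Cons hd_append split: if_splits)
      then have "walk_sign \<tau> (y # bs @ [y]) = 1" "walk_sign \<tau> (x # (as' @ y # cs) @ [x]) = 1"
        using less.hyps[of bs y] less.hyps[of "as' @ y # cs" x] by (auto simp: xs)
      then show ?thesis
        using walk_sign_append[of \<tau> "x # as'" y "bs @ y # cs @ [x]"]
          walk_sign_append[of \<tau> "y # bs" y "cs @ [x]"] walk_sign_append[of \<tau> "x # as'" y "cs @ [x]"]
        by (simp add: xs)
    qed
  qed
qed

lemma walk_sign_cases:
  assumes "\<tau> \<in> edges G \<rightarrow> {1, -1}" and "walk G xs"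
  shows "walk_sign \<tau> xs \<in> {1, -1}"
  using assms(2)
proof (induction xs rule: induct_list012)
  case (3 x y xs)
  then have "\<tau> {x, y} \<in> {1, -1}" using assms(1) by auto
  with 3 show ?case by auto
qed auto

lemma walk_exists:
  assumes "(u, v) \<in> {(x, y). {x, y} \<in> edges G}\<^sup>*"
  obtains xs where "walk G xs" and "xs \<noteq> []" and "hd xs = u" and "last xs = v"
proof -
  have "\<exists>xs. walk G xs \<and> xs \<noteq> [] \<and> hd xs = u \<and> last xs = v"
    using assms
  proof induction
    case base
    show ?case by (rule exI[of _ "[u]"]) simp
  next
    case (step y z)
    then obtain xs where "walk G xs \<and> xs \<noteq> [] \<and> hd xs = u \<and> last xs = y" by blast
    with step show ?case by (intro exI[of _ "xs @ [z]"]) (simp add: successively_append_iff)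
  qed
  with that show thesis by blast
qed

text \<open>The potential \<open>s v\<close> is the sign of a chosen walk from a root
  \<open>r\<close> to \<open>v\<close>. An edge \<open>{u, v}\<close> closes the walks to
  \<open>u\<close> and \<open>v\<close> into a closed walk of sign 1, which forces
  \<open>\<tau> {u, v}\<close> to equal \<open>s u * s v\<close>.\<close>

lemma balanced_switching:
  assumes G: "simple_graph G" and conn: "connected_graph G" and \<tau>: "\<tau> \<in> edges G \<rightarrow> {1, -1}"
    and cyc: "\<And>c. is_cycle G c \<Longrightarrow> cycle_sign (G, \<tau>) c = 1"
  obtains s where "s \<in> verts G \<rightarrow> {1, -1}"
    and "\<And>u v. {u, v} \<in> edges G \<Longrightarrow> \<tau> {u, v} = s u * s v"
proof -
  obtain r where r: "r \<in> verts G" using conn by (auto simp: connected_graph_def)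
  have "\<exists>xs. walk G xs \<and> xs \<noteq> [] \<and> hd xs = r \<and> last xs = v" if "v \<in> verts G" for v
    using conn that r walk_exists[of r v G] unfolding connected_graph_def by metis
  then obtain p where p: "\<And>v. v \<in> verts G \<Longrightarrow>
      walk G (p v) \<and> p v \<noteq> [] \<and> hd (p v) = r \<and> last (p v) = v"
    by metis
  define s where "s v = walk_sign \<tau> (p v)" for v
  have s: "s v \<in> {1, -1}" if "v \<in> verts G" for v
    using p[OF that] walk_sign_cases[OF \<tau>] by (simp add: s_def)
  have "\<tau> {u, v} = s u * s v" if e: "{u, v} \<in> edges G" for u v
  proof -
    have u: "u \<in> verts G" and v: "v \<in> verts G" using simple_graph_edgeD[OF G e] by auto
    define us vs where "us = butlast (p u)" and "vs = butlast (p v)"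
    have pu: "p u = us @ [u]" and pv: "p v = vs @ [v]"
      using p[OF u] p[OF v] append_butlast_last_id unfolding us_def vs_def by metis+
    have hu: "hd (us @ [u]) = r" and hv: "hd (vs @ [v]) = r"
      and wu: "walk G (us @ [u])" and wv: "walk G (vs @ [v])"
      using p[OF u] p[OF v] by (auto simp: pu pv)
    \<comment> \<open>Out along \<open>p u\<close>, across the edge, and back along
      \<open>p v\<close>.\<close>
    let ?w = "us @ u # v # rev vs"
    have "walk G (rev (vs @ [v]))"
      using wv by (subst successively_rev) (simp add: insert_commute)
    then have w: "walk G ?w" using wu e by (auto simp: successively_append_iff successively_Cons)
    have "hd ?w = r" using hu by (cases us) auto
    moreover have l: "last ?w = r"
    proof -
      have "last ?w = last (rev (vs @ [v]))" by simp
      also have "\<dots> = r" using hv by (simp only: last_rev)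
      finally show ?thesis .
    qed
    ultimately have "?w = r # tl ?w" by (cases us) auto
    moreover have "tl ?w \<noteq> []" by (cases us) auto
    ultimately have "?w = r # butlast (tl ?w) @ [r]"
      using l by (metis append_butlast_last_id last_ConsR)
    then have "walk_sign \<tau> ?w = 1" using closed_walk_sign[OF G \<tau> cyc] w by metis
    moreover have "walk_sign \<tau> ?w = s u * (\<tau> {u, v} * s v)"
      using walk_sign_append[of \<tau> us u "v # rev vs"] walk_sign_rev[of \<tau> "vs @ [v]"]
      by (simp add: s_def pu pv)
    ultimately show ?thesis using s[OF u] s[OF v] by auto
  qed
  with s that show thesis by blast
qed

text \<open>If all cycles were even, the all-negative signing would have only positive cycles. Its
  potential then takes opposite values at the ends of every edge, so the vertices with
  \<open>s v = 1\<close> form one colour class.\<close>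

lemma odd_cycle_exists:
  assumes G: "simple_graph G" and "connected_graph G" and "\<not> bipartite_graph G"
  shows "\<exists>c. is_cycle G c \<and> odd (length c)"
proof (rule ccontr)
  assume "\<nexists>c. is_cycle G c \<and> odd (length c)"
  then have even: "even (length c)" if "is_cycle G c" for c
    using that by blast
  have "cycle_sign (G, \<lambda>_. -1) c = 1" if "is_cycle G c" for c
    using even[OF that] by (simp add: cycle_sign_def)
  then obtain s :: "'a \<Rightarrow> int" where s: "s \<in> verts G \<rightarrow> {1, -1}"
    and e: "\<And>u v. {u, v} \<in> edges G \<Longrightarrow> -1 = s u * s v"
    by (rule balanced_switching[OF G assms(2), rotated]) auto
  have "\<exists>u\<in>{v \<in> verts G. s v = 1}. \<exists>v\<in>verts G - {v \<in> verts G. s v = 1}. d = {u, v}"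
    if d: "d \<in> edges G" for d
  proof -
    obtain u v where [simp]: "d = {u, v}" and u: "u \<in> verts G" and v: "v \<in> verts G"
      using simple_graph_edgeE[OF G d] by blast
    have "s u \<in> {1, -1}" "s v \<in> {1, -1}" "-1 = s u * s v" using s u v e d by auto
    then have "s u = 1 \<and> s v = -1 \<or> s v = 1 \<and> s u = -1" by auto
    then show ?thesis
    proof
      assume "s u = 1 \<and> s v = -1"
      with u v show ?thesis by (intro bexI[of _ u] bexI[of _ v]) auto
    next
      assume "s v = 1 \<and> s u = -1"
      with u v show ?thesis by (intro bexI[of _ v] bexI[of _ u]) auto
    qed
  qed
  then have "bipartite_graph G" unfolding bipartite_graph_def
    by (intro exI[of _ "{v \<in> verts G. s v = 1}"]) auto
  with assms show False by blast
qed

section \<open>Adjacency entries, switching isomorphism as an entrywise relation, and skew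
  involutions\<close>

section \<open>Skew involutions\<close>

text \<open>This is the matrix entry indexed by vertices. As 0 marks non-adjacency, one equation
  between entries of signed graphs expresses both the agreement of edges and the agreement of
  signs.\<close>

definition adj :: "'a signed_graph \<Rightarrow> 'a \<Rightarrow> 'a \<Rightarrow> int" where
  "adj \<Gamma> u v = (if {u, v} \<in> edges (fst \<Gamma>) then snd \<Gamma> {u, v} else 0)"

lemma adj_commute: "adj \<Gamma> u v = adj \<Gamma> v u"
  by (simp add: adj_def insert_commute)

lemma adj_cases:
  assumes "signed_graph \<Gamma>"
  shows "adj \<Gamma> u v \<in> {0, 1, -1}"
  using assms by (auto simp: adj_def signed_graph_def)

lemma adj_eq_0_iff:
  assumes "signed_graph \<Gamma>"
  shows "adj \<Gamma> u v = 0 \<longleftrightarrow> {u, v} \<notin> edges (fst \<Gamma>)"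
  using assms by (auto simp: adj_def signed_graph_def Pi_iff)

lemma adj_self:
  assumes "signed_graph \<Gamma>"
  shows "adj \<Gamma> v v = 0"
  using assms simple_graph_edgeD(3)[of "fst \<Gamma>" v v] by (auto simp: adj_def signed_graph_def)

lemma adj_negate: "adj (negate \<Gamma>) u v = - adj \<Gamma> u v"
  by (simp add: adj_def negate_def)

lemma adj_switch:
  assumes "u \<in> verts (fst \<Gamma>)" and "v \<in> verts (fst \<Gamma>)"
  shows "adj (switch U \<Gamma>) u v =
    (if u \<in> U then -1 else 1) * (if v \<in> U then -1 else 1) * adj \<Gamma> u v"
  using assms by (auto simp: adj_def switch_def)

lemma signed_graph_negate: "signed_graph \<Gamma> \<Longrightarrow> signed_graph (negate \<Gamma>)"
  by (auto simp: signed_graph_def negate_def)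

lemma signed_graph_switch: "signed_graph \<Gamma> \<Longrightarrow> signed_graph (switch U \<Gamma>)"
  by (auto simp: signed_graph_def switch_def Pi_iff)

lemma fst_negate [simp]: "fst (negate \<Gamma>) = fst \<Gamma>"
  by (simp add: negate_def)

lemma fst_switch [simp]: "fst (switch U \<Gamma>) = fst \<Gamma>"
  by (simp add: switch_def)

text \<open>The switching set is pulled back along \<open>f\<close> to a vertex signing
  \<open>t\<close>, which is -1 where \<open>f v\<close> lies in it. With the converse below, this
  replaces sets and edge images by a signed permutation similarity of adjacency matrices.\<close>

lemma switching_isomorphicE:
  assumes "\<Gamma> \<simeq>\<^sub>s \<Gamma>'"
  obtains f t where "bij_betw f (verts (fst \<Gamma>)) (verts (fst \<Gamma>'))" and "\<And>v. t v \<in> {1, -1}"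
    and "\<And>u v. u \<in> verts (fst \<Gamma>) \<Longrightarrow> v \<in> verts (fst \<Gamma>) \<Longrightarrow>
      adj \<Gamma> u v = t u * t v * adj \<Gamma>' (f u) (f v)"
proof -
  obtain U f where iso: "signed_isomorphism f \<Gamma> (switch U \<Gamma>')"
    using assms by (auto simp: switching_isomorphic_def)
  then have bij: "bij_betw f (verts (fst \<Gamma>)) (verts (fst \<Gamma>'))"
    by (simp add: signed_isomorphism_def graph_isomorphism_def)
  have "adj \<Gamma> u v = adj (switch U \<Gamma>') (f u) (f v)"
    if "u \<in> verts (fst \<Gamma>)" "v \<in> verts (fst \<Gamma>)" for u v
  proof -
    have "snd (switch U \<Gamma>') (f ` {u, v}) = snd \<Gamma> {u, v}" if "{u, v} \<in> edges (fst \<Gamma>)"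
      using iso that unfolding signed_isomorphism_def by blast
    moreover have "{u, v} \<in> edges (fst \<Gamma>) \<longleftrightarrow> {f u, f v} \<in> edges (fst \<Gamma>')"
      using iso that by (simp add: signed_isomorphism_def graph_isomorphism_def)
    ultimately show ?thesis by (simp add: adj_def)
  qed
  then show thesis using bij
    by (intro that[of f "\<lambda>v. if f v \<in> U then -1 else 1"]) (auto simp: adj_switch bij_betwE)
qed

lemma switching_isomorphicI:
  assumes \<Gamma>: "signed_graph \<Gamma>" and \<Gamma>': "signed_graph \<Gamma>'"
    and bij: "bij_betw f (verts (fst \<Gamma>)) (verts (fst \<Gamma>'))"
    and t: "\<And>v. v \<in> verts (fst \<Gamma>) \<Longrightarrow> t v \<in> {1, -1}"
    and adj: "\<And>u v. u \<in> verts (fst \<Gamma>) \<Longrightarrow> v \<in> verts (fst \<Gamma>) \<Longrightarrow>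
      adj \<Gamma> u v = t u * t v * adj \<Gamma>' (f u) (f v)"
  shows "\<Gamma> \<simeq>\<^sub>s \<Gamma>'"
proof -
  let ?V = "verts (fst \<Gamma>)"
  define U where "U = f ` {v \<in> ?V. t v = -1}"
  have tU: "(if f v \<in> U then -1 else 1) = t v" if "v \<in> ?V" for v
    using t[OF that] that bij by (auto simp: U_def bij_betw_def dest: inj_onD)
  have fV: "f v \<in> verts (fst \<Gamma>')" if "v \<in> ?V" for v
    using bij that by (rule bij_betw_apply)
  have eq: "adj \<Gamma> u v = adj (switch U \<Gamma>') (f u) (f v)" if "u \<in> ?V" "v \<in> ?V" for u v
    using that fV by (simp add: adj_switch tU adj)
  have edge: "{u, v} \<in> edges (fst \<Gamma>) \<longleftrightarrow> {f u, f v} \<in> edges (fst \<Gamma>')" if "u \<in> ?V" "v \<in> ?V" for u v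
    using eq[OF that] adj_eq_0_iff[OF \<Gamma>] adj_eq_0_iff[OF signed_graph_switch[OF \<Gamma>']]
    by (metis fst_switch)
  have "snd (switch U \<Gamma>') (f ` e) = snd \<Gamma> e" if e: "e \<in> edges (fst \<Gamma>)" for e
  proof -
    have sg: "simple_graph (fst \<Gamma>)" using \<Gamma> by (simp add: signed_graph_def)
    obtain u v where [simp]: "e = {u, v}" and uv: "u \<in> ?V" "v \<in> ?V"
      using simple_graph_edgeE[OF sg e] by blast
    show ?thesis using eq[OF uv] edge[OF uv] e by (simp add: adj_def)
  qed
  then have "signed_isomorphism f \<Gamma> (switch U \<Gamma>')"
    using bij edge by (simp add: signed_isomorphism_def graph_isomorphism_def)
  moreover have "U \<subseteq> verts (fst \<Gamma>')" using fV by (auto simp: U_def)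
  ultimately show ?thesis unfolding switching_isomorphic_def by blast
qed

text \<open>The cycle-free counterpart of a weak automorphism of order 2 without fixed vertices:
  \<open>\<phi>\<close> carries the signed graph to its negative up to the switching given by
  \<open>s\<close>. Nothing is required outside the vertex set.\<close>

definition skew_involution :: "'a signed_graph \<Rightarrow> ('a \<Rightarrow> 'a) \<Rightarrow> ('a \<Rightarrow> int) \<Rightarrow> bool" where
  "skew_involution \<Gamma> \<phi> s \<longleftrightarrow>
     (\<forall>v\<in>verts (fst \<Gamma>). \<phi> v \<in> verts (fst \<Gamma>) \<and> \<phi> (\<phi> v) = v \<and> \<phi> v \<noteq> v \<and> s v \<in> {1, -1}) \<and>
     (\<forall>u\<in>verts (fst \<Gamma>). \<forall>v\<in>verts (fst \<Gamma>). adj \<Gamma> (\<phi> u) (\<phi> v) = - (s u * s v * adj \<Gamma> u v))"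

lemma skew_involutionD:
  assumes "skew_involution \<Gamma> \<phi> s" and "v \<in> verts (fst \<Gamma>)"
  shows "\<phi> v \<in> verts (fst \<Gamma>)" and "\<phi> (\<phi> v) = v" and "\<phi> v \<noteq> v" and "s v \<in> {1, -1}"
    and "u \<in> verts (fst \<Gamma>) \<Longrightarrow> adj \<Gamma> (\<phi> u) (\<phi> v) = - (s u * s v * adj \<Gamma> u v)"
    and "s v * s (\<phi> v) \<in> {1, -1}"
proof -
  have s: "s w \<in> {1, -1}" if "w \<in> verts (fst \<Gamma>)" for w
    using assms(1) that unfolding skew_involution_def by blast
  show "\<phi> v \<in> verts (fst \<Gamma>)" and "\<phi> (\<phi> v) = v" and "\<phi> v \<noteq> v" and "s v \<in> {1, -1}"
    and "u \<in> verts (fst \<Gamma>) \<Longrightarrow> adj \<Gamma> (\<phi> u) (\<phi> v) = - (s u * s v * adj \<Gamma> u v)"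
    using assms unfolding skew_involution_def by blast+
  with s[of v] s[of "\<phi> v"] assms(2) show "s v * s (\<phi> v) \<in> {1, -1}" by auto
qed

text \<open>Conjugation by the isomorphism \<open>f\<close> carries the involution over; only the
  vertex signing has to be corrected.\<close>

lemma skew_involution_transfer:
  assumes iso: "\<Gamma> \<simeq>\<^sub>s \<Gamma>'" and skew: "skew_involution \<Gamma>' \<phi> s"
  obtains \<psi> r where "skew_involution \<Gamma> \<psi> r"
proof -
  obtain f t where bij: "bij_betw f (verts (fst \<Gamma>)) (verts (fst \<Gamma>'))"
    and t: "\<And>v. t v \<in> {1, -1}"
    and adj: "\<And>u v. u \<in> verts (fst \<Gamma>) \<Longrightarrow> v \<in> verts (fst \<Gamma>) \<Longrightarrow>
      adj \<Gamma> u v = t u * t v * adj \<Gamma>' (f u) (f v)"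
    using switching_isomorphicE[OF iso] by blast
  let ?V = "verts (fst \<Gamma>)"
  let ?g = "inv_into ?V f"
  define \<psi> where "\<psi> v = ?g (\<phi> (f v))" for v
  \<comment> \<open>The factors are the signs of moving from \<open>\<Gamma>\<close> to
    \<open>\<Gamma>'\<close> at \<open>v\<close>, of applying \<open>\<phi>\<close> at
    \<open>f v\<close>, and of moving back at \<open>\<psi> v\<close>.\<close>
  define r where "r v = t v * t (\<psi> v) * s (f v)" for v
  note skD = skew_involutionD[OF skew]
  have fV: "f v \<in> verts (fst \<Gamma>')" if "v \<in> ?V" for v
    using bij that by (rule bij_betw_apply)
  have f\<psi>: "f (\<psi> v) = \<phi> (f v)" if "v \<in> ?V" for v
    unfolding \<psi>_def using bij skD(1)[OF fV[OF that]] by (rule bij_betw_inv_into_right)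
  have \<psi>V: "\<psi> v \<in> ?V" if "v \<in> ?V" for v
    unfolding \<psi>_def using bij_betw_inv_into[OF bij] skD(1)[OF fV[OF that]] by (rule bij_betw_apply)
  have inv: "\<psi> (\<psi> v) = v" if "v \<in> ?V" for v
    using f\<psi>[OF that] skD(2)[OF fV[OF that]] bij_betw_inv_into_left[OF bij that]
    by (simp add: \<psi>_def)
  have nofix: "\<psi> v \<noteq> v" if "v \<in> ?V" for v
    using f\<psi>[OF that] skD(3)[OF fV[OF that]] by metis
  have r: "r v \<in> {1, -1}" if "v \<in> ?V" for v
    using t[of v] t[of "\<psi> v"] skD(4)[OF fV[OF that]] by (auto simp: r_def)
  have tt: "t v * t v = 1" for v using t[of v] by auto
  have "adj \<Gamma> (\<psi> u) (\<psi> v) = - (r u * r v * adj \<Gamma> u v)" if u: "u \<in> ?V" and v: "v \<in> ?V" for u v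
  proof -
    have "adj \<Gamma> (\<psi> u) (\<psi> v) = t (\<psi> u) * t (\<psi> v) * - (s (f u) * s (f v) * adj \<Gamma>' (f u) (f v))"
      by (simp add: adj \<psi>V u v f\<psi> skD(5) fV)
    \<comment> \<open>The squares \<open>t u * t u\<close> and \<open>t v * t v\<close> equal 1 and
      are inserted so that one factor of each goes into \<open>r\<close> and the other into
      \<open>adj \<Gamma> u v\<close>.\<close>
    also have "\<dots> = - (((t u * t u) * t (\<psi> u) * s (f u)) * ((t v * t v) * t (\<psi> v) * s (f v)) * adj \<Gamma>' (f u) (f v))"
      by (simp add: tt)
    also have "\<dots> = - (r u * r v * adj \<Gamma> u v)"
      by (simp add: r_def adj[OF u v] mult_ac)
    finally show ?thesis .
  qed
  with \<psi>V inv nofix r have "skew_involution \<Gamma> \<psi> r" by (simp add: skew_involution_def)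
  with that show thesis .
qed

section \<open>Passage between principal weak automorphisms and skew involutions\<close>

section \<open>Weak automorphisms\<close>

text \<open>The \<open>LEAST\<close> in \<open>aut_order\<close> is informative only when some
  positive power is the identity; finiteness of the permuted set guarantees one.\<close>

lemma aut_order_funpow:
  assumes "finite A" and "\<psi> permutes A"
  shows "0 < aut_order \<psi>" and "\<psi> ^^ aut_order \<psi> = id"
proof -
  have "permutation \<psi>" using assms by (auto simp: permutation_permutes)
  then obtain k where "0 < k \<and> \<psi> ^^ k = id" using permutation_is_nilpotent by blast
  then have "0 < aut_order \<psi> \<and> \<psi> ^^ aut_order \<psi> = id"
    unfolding aut_order_def by (rule LeastI)
  then show "0 < aut_order \<psi>" and "\<psi> ^^ aut_order \<psi> = id" by auto
qed

text \<open>Around a cycle every vertex is the start of one edge and the end of one; this lets the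
  two products of vertex signs be identified.\<close>

lemma prod_cyclic_shift: "(\<Prod>i<n. f (Suc i mod n)) = (\<Prod>i<n. f i)"
proof (cases n)
  case (Suc m)
  have "(\<Prod>i<n. f (Suc i mod n)) = (\<Prod>i<m. f (Suc i mod n)) * f 0" by (simp add: Suc)
  also have "(\<Prod>i<m. f (Suc i mod n)) = (\<Prod>i<m. f (Suc i))"
    by (intro prod.cong) (auto simp: Suc)
  finally show ?thesis unfolding Suc by (simp only: prod.lessThan_Suc_shift mult.commute)
qed simp

lemma is_cycleD:
  assumes "is_cycle G c" and "i < length c"
  shows "c ! i \<in> verts G" and "c ! (Suc i mod length c) \<in> verts G"
    and "{c ! i, c ! (Suc i mod length c)} \<in> edges G"
proof -
  have "Suc i mod length c < length c" using assms(2) by (intro mod_less_divisor) auto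
  then show "c ! i \<in> verts G" and "c ! (Suc i mod length c) \<in> verts G"
    using assms unfolding is_cycle_def by (meson nth_mem subsetD)+
  show "{c ! i, c ! (Suc i mod length c)} \<in> edges G"
    using assms unfolding is_cycle_def cycle_edge_def by blast
qed

lemma cycle_edge_map: "i < length c \<Longrightarrow> cycle_edge (map \<phi> c) i = \<phi> ` cycle_edge c i"
  using mod_less_divisor[of "length c" "Suc i"]
  by (simp add: cycle_edge_def length_greater_0_conv[symmetric] del: length_greater_0_conv)

lemma cycle_sign_conv_adj:
  assumes "is_cycle (fst \<Gamma>) c"
  shows "cycle_sign \<Gamma> c = (\<Prod>i<length c. adj \<Gamma> (c ! i) (c ! (Suc i mod length c)))"
  unfolding cycle_sign_def
  by (rule prod.cong) (auto simp: cycle_edge_def adj_def is_cycleD[OF assms])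

lemma is_cycle_map:
  assumes "\<phi> \<in> automorphisms G" and "is_cycle G c"
  shows "is_cycle G (map \<phi> c)"
proof -
  have \<phi>: "\<phi> permutes verts G" and e: "\<And>u v. u \<in> verts G \<Longrightarrow> v \<in> verts G \<Longrightarrow>
      {u, v} \<in> edges G \<Longrightarrow> {\<phi> u, \<phi> v} \<in> edges G"
    using assms(1) by (auto simp: automorphisms_def graph_isomorphism_def)
  have "cycle_edge (map \<phi> c) i \<in> edges G" if "i < length c" for i
    using is_cycleD[OF assms(2) that] e that by (simp add: cycle_edge_map) (simp add: cycle_edge_def)
  then show ?thesis using assms(2) \<phi> permutes_in_image[OF \<phi>] permutes_inj[OF \<phi>]
    by (auto simp: is_cycle_def distinct_map inj_on_def inj_def)
qed

text \<open>Around a cycle the vertex signs cancel and only one factor -1 per edge survives, which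
  is the weak automorphism condition. An odd cycle excludes order 1, so order 2 is minimal, and the
  pair \<open>\<phi>'\<close>, \<open>s\<close> also witnesses sign-symmetry.\<close>

lemma skew_involution_imp_NFS1:
  assumes conn: "connected_graph G" and nb: "\<not> bipartite_graph G"
    and \<Gamma>: "signed_graph (G, \<sigma>)" and skew: "skew_involution (G, \<sigma>) \<phi>' s"
  shows "(G, \<sigma>) \<in> NFS1 G"
proof -
  have G: "simple_graph G" and fin: "finite (verts G)"
    using \<Gamma> by (auto simp: signed_graph_def simple_graph_def)
  \<comment> \<open>Automorphisms must be the identity outside the vertex set, where
    \<open>\<phi>'\<close> is arbitrary.\<close>
  define \<phi> where "\<phi> v = (if v \<in> verts G then \<phi>' v else v)" for v
  have "skew_involution (G, \<sigma>) \<phi> s" using skew by (auto simp: skew_involution_def \<phi>_def)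
  note skD = skew_involutionD[OF this, unfolded fst_conv]
  have inv: "\<phi> (\<phi> v) = v" for v
  proof (cases "v \<in> verts G")
    case False
    then have "\<phi> v = v" by (simp add: \<phi>_def)
    then show ?thesis by simp
  qed (rule skD(2))
  have perm: "\<phi> permutes verts G"
    using skD(1) inv by (intro bij_imp_permutes bij_betwI[of _ _ _ \<phi>]) (auto, simp add: \<phi>_def)
  have bij: "bij_betw \<phi> (verts G) (verts G)" using perm by (rule permutes_imp_bij)
  have edge: "{u, v} \<in> edges G \<longleftrightarrow> {\<phi> u, \<phi> v} \<in> edges G" if "u \<in> verts G" "v \<in> verts G" for u v
  proof -
    have "adj (G, \<sigma>) u v = 0 \<longleftrightarrow> adj (G, \<sigma>) (\<phi> u) (\<phi> v) = 0"
      using skD(4)[OF that(1)] skD(4)[OF that(2)] by (auto simp: skD(5) that)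
    then show ?thesis by (simp add: adj_eq_0_iff[OF \<Gamma>])
  qed
  have aut: "\<phi> \<in> automorphisms G"
    using perm bij edge by (simp add: automorphisms_def graph_isomorphism_def)
  have sgn: "cycle_sign (G, \<sigma>) (map \<phi> c) = (-1) ^ length c * cycle_sign (G, \<sigma>) c"
    if c: "is_cycle G c" for c
  proof -
    let ?n = "length c" and ?j = "\<lambda>i. Suc i mod length c"
    have ne: "c \<noteq> []" using c by (auto simp: is_cycle_def)
    have "cycle_sign (G, \<sigma>) (map \<phi> c) = (\<Prod>i<?n. adj (G, \<sigma>) (\<phi> (c ! i)) (\<phi> (c ! ?j i)))"
      unfolding cycle_sign_conv_adj[of "(G, \<sigma>)", unfolded fst_conv, OF is_cycle_map[OF aut c]] length_map
      using ne by (intro prod.cong) auto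
    also have "\<dots> = (\<Prod>i<?n. -1 * s (c ! i) * s (c ! ?j i) * adj (G, \<sigma>) (c ! i) (c ! ?j i))"
      using is_cycleD[OF c] by (intro prod.cong) (auto simp: skD(5))
    also have "\<dots> = (-1) ^ ?n * ((\<Prod>i<?n. s (c ! i)) * (\<Prod>i<?n. s (c ! ?j i))) * cycle_sign (G, \<sigma>) c"
      using c by (simp add: prod.distrib cycle_sign_conv_adj mult.assoc del: mult_minus_left mult_minus1)
    also have "(\<Prod>i<?n. s (c ! ?j i)) = (\<Prod>i<?n. s (c ! i))"
      by (rule prod_cyclic_shift)
    also have "(\<Prod>i<?n. s (c ! i)) * (\<Prod>i<?n. s (c ! i)) = (\<Prod>i<?n. s (c ! i) * s (c ! i))"
      by (simp add: prod.distrib)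
    also have "\<dots> = 1"
      using skD(4) is_cycleD(1)[OF c] by (intro prod.neutral) fastforce
    finally show ?thesis by simp
  qed
  have weak: "weak_automorphism (G, \<sigma>) \<phi>"
    using aut sgn by (simp add: weak_automorphism_def)
  obtain v where v: "v \<in> verts G" using conn by (auto simp: connected_graph_def)
  then have "\<phi> \<noteq> id" using skD(3) by force
  then have "2 \<le> k" if "0 < k \<and> \<phi> ^^ k = id" for k
    using that by (cases "k = 1") auto
  moreover have "\<phi> ^^ 2 = id" using inv by (auto simp: numeral_2_eq_2)
  ultimately have ord: "aut_order \<phi> = 2"
    unfolding aut_order_def by (intro Least_equality) auto
  \<comment> \<open>Order 1 would make the identity a weak automorphism, so the nonzero sign of an
    odd cycle would equal its own negative.\<close>
  have "2 \<le> aut_order \<psi>" if \<psi>: "weak_automorphism (G, \<sigma>) \<psi>" for \<psi>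
  proof (rule ccontr)
    assume "\<not> ?thesis"
    have "\<psi> permutes verts G" using \<psi> by (simp add: weak_automorphism_def automorphisms_def)
    note ord = aut_order_funpow[OF fin this]
    with \<open>\<not> 2 \<le> aut_order \<psi>\<close> have "aut_order \<psi> = 1" by simp
    with ord have "\<psi> = id" by simp
    obtain c where c: "is_cycle G c" "odd (length c)"
      using odd_cycle_exists[OF G conn nb] by blast
    then have "cycle_sign (G, \<sigma>) c = - cycle_sign (G, \<sigma>) c"
      using \<psi> unfolding \<open>\<psi> = id\<close> weak_automorphism_def by fastforce
    moreover have "cycle_sign (G, \<sigma>) c \<noteq> 0"
      using c is_cycleD(3)[OF c(1)] by (simp add: cycle_sign_conv_adj adj_eq_0_iff[OF \<Gamma>])
    ultimately show False by simp
  qed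
  then have princ: "principal_weak_automorphism (G, \<sigma>) \<phi>"
    using weak ord by (simp add: principal_weak_automorphism_def)
  have "(G, \<sigma>) \<simeq>\<^sub>s negate (G, \<sigma>)"
  proof (rule switching_isomorphicI[where f = \<phi> and t = s])
    show "adj (G, \<sigma>) u v = s u * s v * adj (negate (G, \<sigma>)) (\<phi> u) (\<phi> v)"
      if "u \<in> verts (fst (G, \<sigma>))" "v \<in> verts (fst (G, \<sigma>))" for u v
      using that skD(4)[of u] skD(4)[of v] by (auto simp: adj_negate skD(5))
  qed (use \<Gamma> bij skD(4) in \<open>simp_all add: signed_graph_negate\<close>)
  then have "(G, \<sigma>) \<in> S1 G" using \<Gamma> princ ord by (auto simp: S1_def sign_symmetric_def)
  moreover have "fixed_verts G \<phi> = {}" using skD(3) by (auto simp: fixed_verts_def)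
  ultimately show ?thesis using princ ord by (auto simp: NFS1_def)
qed

text \<open>The defect signing \<open>\<tau>\<close> compares an edge with its image. The weak
  automorphism condition makes it positive on every cycle, so it is a coboundary, and its potential
  is the required \<open>s\<close>.\<close>

lemma NFS1_imp_skew_involution:
  assumes conn: "connected_graph G" and NFS: "(G, \<sigma>) \<in> NFS1 G"
  obtains \<phi> s where "skew_involution (G, \<sigma>) \<phi> s"
proof -
  have \<Gamma>: "signed_graph (G, \<sigma>)" using NFS by (simp add: NFS1_def S1_def)
  then have G: "simple_graph G" and fin: "finite (verts G)"
    and \<sigma>: "\<And>e. e \<in> edges G \<Longrightarrow> \<sigma> e \<in> {1, -1}"
    by (auto simp: signed_graph_def simple_graph_def)
  obtain \<phi> where weak: "weak_automorphism (G, \<sigma>) \<phi>" and ord: "aut_order \<phi> = 2"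
    and nofix: "fixed_verts G \<phi> = {}"
    using NFS by (auto simp: NFS1_def principal_weak_automorphism_def)
  have aut: "\<phi> \<in> automorphisms G" using weak by (simp add: weak_automorphism_def)
  then have perm: "\<phi> permutes verts G"
    and edge: "\<And>u v. u \<in> verts G \<Longrightarrow> v \<in> verts G \<Longrightarrow> {u, v} \<in> edges G \<longleftrightarrow> {\<phi> u, \<phi> v} \<in> edges G"
    by (auto simp: automorphisms_def graph_isomorphism_def)
  have "\<phi> ^^ 2 = id" using aut_order_funpow(2)[OF fin perm] ord by simp
  then have inv: "\<phi> (\<phi> v) = v" for v by (simp add: numeral_2_eq_2 fun_eq_iff)
  have edge_image: "\<phi> ` e \<in> edges G" if e: "e \<in> edges G" for e
  proof -
    obtain u v where "e = {u, v}" "u \<in> verts G" "v \<in> verts G" using simple_graph_edgeE[OF G e] by blast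
    with e show ?thesis using edge[of u v] by simp
  qed
  define \<tau> where "\<tau> e = - \<sigma> e * \<sigma> (\<phi> ` e)" for e
  have "\<tau> \<in> edges G \<rightarrow> {1, -1}"
  proof
    fix e
    assume "e \<in> edges G"
    then show "\<tau> e \<in> {1, -1}" using \<sigma>[of e] \<sigma>[of "\<phi> ` e"] edge_image[of e] by (auto simp: \<tau>_def)
  qed
  moreover have "cycle_sign (G, \<tau>) c = 1" if c: "is_cycle G c" for c
  proof -
    have "cycle_sign (G, \<tau>) c = (\<Prod>i<length c. -1 * \<sigma> (cycle_edge c i) * \<sigma> (cycle_edge (map \<phi> c) i))"
      by (simp add: cycle_sign_def \<tau>_def cycle_edge_map)
    also have "\<dots> = (-1) ^ length c * cycle_sign (G, \<sigma>) c * cycle_sign (G, \<sigma>) (map \<phi> c)"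
      by (simp add: cycle_sign_def prod.distrib del: mult_minus_left mult_minus1)
    \<comment> \<open>For odd length the factor -1 cancels against the sign reversal under
      \<open>\<phi>\<close>; for even length neither occurs.\<close>
    also have "\<dots> = cycle_sign (G, \<sigma>) c * cycle_sign (G, \<sigma>) c"
      using weak c by (cases "even (length c)") (simp_all add: weak_automorphism_def)
    also have "\<dots> = (\<Prod>i<length c. \<sigma> (cycle_edge c i) * \<sigma> (cycle_edge c i))"
      by (simp add: cycle_sign_def prod.distrib)
    also have "\<dots> = 1"
      using \<sigma> c unfolding is_cycle_def by (intro prod.neutral) fastforce
    finally show ?thesis .
  qed
  ultimately obtain s where s: "s \<in> verts G \<rightarrow> {1, -1}"
    and \<tau>s: "\<And>u v. {u, v} \<in> edges G \<Longrightarrow> \<tau> {u, v} = s u * s v"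
    using balanced_switching[OF G conn] by metis
  have "adj (G, \<sigma>) (\<phi> u) (\<phi> v) = - (s u * s v * adj (G, \<sigma>) u v)"
    if "u \<in> verts G" "v \<in> verts G" for u v
  proof (cases "{u, v} \<in> edges G")
    case True
    then have "s u * s v = - \<sigma> {u, v} * \<sigma> {\<phi> u, \<phi> v}" using \<tau>s[OF True] by (simp add: \<tau>_def)
    with \<sigma>[OF True] True edge[OF that] show ?thesis by (auto simp: adj_def)
  next
    case False
    with edge[OF that] show ?thesis by (simp add: adj_def)
  qed
  moreover have "\<phi> v \<noteq> v" if "v \<in> verts G" for v using nofix that by (auto simp: fixed_verts_def)
  ultimately have "skew_involution (G, \<sigma>) \<phi> s"
    using s inv permutes_in_image[OF perm] by (auto simp: skew_involution_def)
  with that show thesis .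
qed

section \<open>Block forms, and how a skew involution is brought to one by switching\<close>

section \<open>Block matrices\<close>

text \<open>The forms \<open>\<Gamma>\<^sup>a\<close> (\<open>\<delta> = 1\<close>) and \<open>\<Gamma>\<^sup>b\<close> (\<open>\<delta> = -1\<close>) treated uniformly.\<close>

definition block_form :: "int \<Rightarrow> 'a signed_graph \<Rightarrow> bool" where
  "block_form \<delta> \<Gamma> \<longleftrightarrow> (\<exists>vs n B X. vertex_enumeration (fst \<Gamma>) vs \<and>
     B \<in> carrier_mat n n \<and> X \<in> carrier_mat n n \<and>
     elements_mat B \<subseteq> {0, 1, -1} \<and> elements_mat X \<subseteq> {0, 1, -1} \<and>
     B = transpose_mat B \<and> (\<forall>i<n. B $$ (i, i) = 0) \<and> X = \<delta> \<cdot>\<^sub>m transpose_mat X \<and>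
     adjacency_matrix \<Gamma> vs = four_block_mat B X (\<delta> \<cdot>\<^sub>m X) (- B))"

lemma smult_mat_one: "(1 :: int) \<cdot>\<^sub>m A = A"
  by (intro eq_matI) auto

lemma smult_mat_minus_one: "(-1 :: int) \<cdot>\<^sub>m A = - A"
  by (intro eq_matI) auto

lemma has_form_a_iff: "has_form_a \<Gamma> \<longleftrightarrow> block_form 1 \<Gamma>"
  by (simp add: has_form_a_def block_form_def smult_mat_one)

lemma has_form_b_iff: "has_form_b \<Gamma> \<longleftrightarrow> block_form (-1) \<Gamma>"
  by (simp add: has_form_b_def block_form_def smult_mat_minus_one)

lemma adjacency_matrix_nth:
  "i < length vs \<Longrightarrow> j < length vs \<Longrightarrow> adjacency_matrix \<Gamma> vs $$ (i, j) = adj \<Gamma> (vs ! i) (vs ! j)"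
  by (simp add: adjacency_matrix_def adj_def)

text \<open>The involution exchanges the positions \<open>i\<close> and \<open>i + n\<close>, that
  is, the two halves of the enumeration.\<close>

lemma block_form_imp_skew_involution:
  assumes form: "block_form \<delta> \<Gamma>" and \<delta>: "\<delta> \<in> {1, -1}"
  obtains \<phi> s where "skew_involution \<Gamma> \<phi> s"
proof -
  obtain vs n B X where vs: "vertex_enumeration (fst \<Gamma>) vs"
    and B: "B \<in> carrier_mat n n" and X: "X \<in> carrier_mat n n"
    and A: "adjacency_matrix \<Gamma> vs = four_block_mat B X (\<delta> \<cdot>\<^sub>m X) (- B)"
    using form by (auto simp: block_form_def)
  have "dim_row (adjacency_matrix \<Gamma> vs) = n + n" using A B by simp
  then have len: "length vs = n + n" by (simp add: adjacency_matrix_def)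
  have dist: "distinct vs" and V: "set vs = verts (fst \<Gamma>)"
    using vs by (auto simp: vertex_enumeration_def)
  have entry: "adj \<Gamma> (vs ! i) (vs ! j) = four_block_mat B X (\<delta> \<cdot>\<^sub>m X) (- B) $$ (i, j)"
    if "i < n + n" "j < n + n" for i j
    using that by (simp add: adjacency_matrix_nth len flip: A)
  define idx where "idx v = (THE i. i < n + n \<and> vs ! i = v)" for v
  have idx: "idx (vs ! i) = i" if "i < n + n" for i
    unfolding idx_def using that len by (intro the_equality) (auto simp: nth_eq_iff_index_eq[OF dist])
  define p where "p i = (if i < n then i + n else i - n)" for i
  define \<phi> where "\<phi> v = vs ! p (idx v)" for v
  \<comment> \<open>Exchanging the halves takes an entry of \<open>X\<close> to the matching entry
    of \<open>\<delta> \<cdot>\<^sub>m X\<close>, so the product of the signs across the halves must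
    be \<open>- \<delta>\<close>; within a half the signs square to 1 and \<open>B\<close> is
    exchanged with \<open>- B\<close>.\<close>
  define s where "s v = (if idx v < n then 1 else - \<delta>)" for v
  have p: "p i < n + n" "p (p i) = i" "p i \<noteq> i" if "i < n + n" for i
    using that by (auto simp: p_def)
  have ex: "\<exists>i<n + n. v = vs ! i" if "v \<in> verts (fst \<Gamma>)" for v
    using that len by (auto simp: in_set_conv_nth simp flip: V)
  have "\<phi> v \<in> verts (fst \<Gamma>) \<and> \<phi> (\<phi> v) = v \<and> \<phi> v \<noteq> v \<and> s v \<in> {1, -1}"
    if v: "v \<in> verts (fst \<Gamma>)" for v
  proof -
    obtain i where i: "i < n + n" and [simp]: "v = vs ! i" using ex[OF v] by blast
    have "vs ! p i \<noteq> vs ! i" using p[OF i] i dist len by (simp add: nth_eq_iff_index_eq)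
    moreover have "vs ! p i \<in> verts (fst \<Gamma>)" using p(1)[OF i] len by (simp flip: V)
    ultimately show ?thesis using \<delta> i p[OF i] by (auto simp: \<phi>_def s_def idx)
  qed
  moreover have "adj \<Gamma> (\<phi> u) (\<phi> v) = - (s u * s v * adj \<Gamma> u v)"
    if u: "u \<in> verts (fst \<Gamma>)" and v: "v \<in> verts (fst \<Gamma>)" for u v
  proof -
    obtain i j where i: "i < n + n" and j: "j < n + n" and [simp]: "u = vs ! i" "v = vs ! j"
      using ex[OF u] ex[OF v] by blast
    have "adj \<Gamma> (vs ! p i) (vs ! p j)
        = - ((if i < n then 1 else - \<delta>) * (if j < n then 1 else - \<delta>) * adj \<Gamma> (vs ! i) (vs ! j))"
      using i j B X \<delta> unfolding entry[OF p(1)[OF i] p(1)[OF j]] entry[OF i j] by (auto simp: p_def)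
    then show ?thesis using i j by (simp add: \<phi>_def s_def idx)
  qed
  ultimately have "skew_involution \<Gamma> \<phi> s" unfolding skew_involution_def by blast
  with that show thesis .
qed

lemma elements_mat_mat_subset:
  assumes "\<And>i j. f (i, j) \<in> S"
  shows "elements_mat (mat n m f) \<subseteq> S"
  using assms by (auto simp: elements_mat_def)

text \<open>\<open>R\<close> contains one vertex of each orbit. Listing \<open>R\<close> and then
  its images in the same order lets \<open>\<phi>\<close> act as the exchange of halves, and the
  values of \<open>s\<close> determine the lower blocks from the upper ones.\<close>

lemma skew_involution_imp_block_form:
  assumes \<Gamma>: "signed_graph \<Gamma>" and skew: "skew_involution \<Gamma> \<phi> s"
    and R: "R \<inter> \<phi> ` R = {}" "R \<union> \<phi> ` R = verts (fst \<Gamma>)"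
    and s: "\<And>v. v \<in> R \<Longrightarrow> s v = 1 \<and> s (\<phi> v) = - \<delta>"
  shows "block_form \<delta> \<Gamma>"
proof -
  note skD = skew_involutionD[OF skew]
  have "finite (verts (fst \<Gamma>))" using \<Gamma> by (simp add: signed_graph_def simple_graph_def)
  then have "finite R" by (simp flip: R(2))
  then obtain rs where rs: "set rs = R" "distinct rs" using finite_distinct_list by blast
  define n where "n = length rs"
  define vs where "vs = rs @ map \<phi> rs"
  define B where "B = mat n n (\<lambda>(i, j). adj \<Gamma> (rs ! i) (rs ! j))"
  define X where "X = mat n n (\<lambda>(i, j). adj \<Gamma> (rs ! i) (\<phi> (rs ! j)))"
  have RV: "v \<in> verts (fst \<Gamma>)" if "v \<in> R" for v using R(2) that by blast
  have "inj_on \<phi> R" using RV skD(2) by (metis inj_onI)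
  then have enum: "vertex_enumeration (fst \<Gamma>) vs"
    using rs R by (simp add: vertex_enumeration_def vs_def distinct_map)
  have mem: "rs ! i \<in> R" if "i < n" for i using that rs by (auto simp: n_def)
  \<comment> \<open>The skew relation is applied to \<open>u\<close> and \<open>\<phi> v\<close>,
    since \<open>v\<close> is the image of \<open>\<phi> v\<close>. It yields both the lower left
    block and, with symmetry of \<open>adj\<close>, the relation between \<open>X\<close> and its
    transpose.\<close>
  have rev: "adj \<Gamma> (\<phi> u) v = \<delta> * adj \<Gamma> u (\<phi> v)" if "u \<in> R" "v \<in> R" for u v
    using skD(5)[of "\<phi> v" u] that RV s by (simp add: skD)
  have low: "adj \<Gamma> (\<phi> u) (\<phi> v) = - adj \<Gamma> u v" if "u \<in> R" "v \<in> R" for u v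
    using that RV s by (simp add: skD(5))
  have "adjacency_matrix \<Gamma> vs = four_block_mat B X (\<delta> \<cdot>\<^sub>m X) (- B)"
  proof (rule eq_matI)
    fix i j
    assume "i < dim_row (four_block_mat B X (\<delta> \<cdot>\<^sub>m X) (- B))"
      and "j < dim_col (four_block_mat B X (\<delta> \<cdot>\<^sub>m X) (- B))"
    then have ij: "i < n + n" "j < n + n" by (auto simp: B_def)
    have "adjacency_matrix \<Gamma> vs $$ (i, j) = adj \<Gamma> (vs ! i) (vs ! j)"
      using ij by (simp add: adjacency_matrix_nth vs_def n_def)
    then show "adjacency_matrix \<Gamma> vs $$ (i, j) = four_block_mat B X (\<delta> \<cdot>\<^sub>m X) (- B) $$ (i, j)"
      using ij by (auto simp: B_def X_def vs_def nth_append low rev mem simp flip: n_def)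
  qed (auto simp: adjacency_matrix_def vs_def n_def B_def)
  moreover have "X = \<delta> \<cdot>\<^sub>m transpose_mat X"
  proof (rule eq_matI)
    fix i j
    assume "i < dim_row (\<delta> \<cdot>\<^sub>m transpose_mat X)" and "j < dim_col (\<delta> \<cdot>\<^sub>m transpose_mat X)"
    then have ij: "i < n" "j < n" by (auto simp: X_def)
    then show "X $$ (i, j) = (\<delta> \<cdot>\<^sub>m transpose_mat X) $$ (i, j)"
      using rev[OF mem[OF ij(2)] mem[OF ij(1)]] by (simp add: X_def adj_commute)
  qed (auto simp: X_def)
  moreover have "B = transpose_mat B"
    by (intro eq_matI) (auto simp: B_def adj_commute)
  moreover have "elements_mat B \<subseteq> {0, 1, -1}" "elements_mat X \<subseteq> {0, 1, -1}"
    unfolding B_def X_def using adj_cases[OF \<Gamma>] by (intro elements_mat_mat_subset; simp)+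
  moreover have "\<forall>i<n. B $$ (i, i) = 0" by (simp add: B_def adj_self[OF \<Gamma>])
  moreover have "B \<in> carrier_mat n n" "X \<in> carrier_mat n n" by (simp_all add: B_def X_def)
  ultimately show ?thesis using enum unfolding block_form_def by blast
qed

text \<open>The vertex type carries no order, so an injection into the naturals decides which of
  \<open>v\<close> and \<open>\<phi> v\<close> is taken.\<close>

lemma involution_transversal:
  assumes "finite V" and "\<And>v. v \<in> V \<Longrightarrow> \<phi> v \<in> V \<and> \<phi> (\<phi> v) = v \<and> \<phi> v \<noteq> v"
  obtains R where "R \<inter> \<phi> ` R = {}" and "R \<union> \<phi> ` R = V"
proof -
  obtain g :: "'a \<Rightarrow> nat" where g: "inj_on g V" using finite_imp_inj_to_nat_seg[OF assms(1)] by blast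
  define R where "R = {v \<in> V. g v < g (\<phi> v)}"
  have "v \<in> R \<union> \<phi> ` R" if v: "v \<in> V" for v
  proof -
    have "g v \<noteq> g (\<phi> v)" using assms(2)[OF v] g v by (auto dest: inj_onD)
    then consider "v \<in> R" | "\<phi> v \<in> R" using assms(2)[OF v] v by (fastforce simp: R_def)
    then show ?thesis using assms(2)[OF v] by cases (auto intro: rev_image_eqI)
  qed
  then have "R \<union> \<phi> ` R = V" using assms(2) by (auto simp: R_def)
  moreover have "\<phi> v \<notin> R" if "v \<in> R" for v
    using assms(2)[of v] that by (auto simp: R_def)
  then have "R \<inter> \<phi> ` R = {}" by blast
  ultimately show thesis using that by blast
qed

text \<open>Applying the relation twice multiplies an entry by four vertex signs and returns it
  unchanged. On an edge the entry is nonzero, so the two products agree at its ends; connectedness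
  spreads this to all vertices.\<close>

lemma skew_involution_constant:
  assumes conn: "connected_graph (fst \<Gamma>)" and \<Gamma>: "signed_graph \<Gamma>" and skew: "skew_involution \<Gamma> \<phi> s"
    and u: "u \<in> verts (fst \<Gamma>)" and v: "v \<in> verts (fst \<Gamma>)"
  shows "s u * s (\<phi> u) = s v * s (\<phi> v)"
proof -
  note skD = skew_involutionD[OF skew]
  have "(u, v) \<in> {(x, y). {x, y} \<in> edges (fst \<Gamma>)}\<^sup>*" using conn u v by (auto simp: connected_graph_def)
  then show ?thesis
  proof induction
    case (step y z)
    have G: "simple_graph (fst \<Gamma>)" using \<Gamma> by (simp add: signed_graph_def)
    have e: "{y, z} \<in> edges (fst \<Gamma>)" using step.hyps by simp
    then have y: "y \<in> verts (fst \<Gamma>)" and z: "z \<in> verts (fst \<Gamma>)" using simple_graph_edgeD[OF G e] by auto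
    have "adj \<Gamma> y z = adj \<Gamma> (\<phi> (\<phi> y)) (\<phi> (\<phi> z))" using y z by (simp add: skD)
    also have "\<dots> = s (\<phi> y) * s (\<phi> z) * (s y * s z) * adj \<Gamma> y z"
      using skD(5)[of "\<phi> z" "\<phi> y"] skD(5)[of z y] skD(1) y z by simp
    finally have "(s y * s (\<phi> y)) * (s z * s (\<phi> z)) = 1"
      using e adj_eq_0_iff[OF \<Gamma>, of y z] by (simp add: mult_ac)
    moreover have "s y * s (\<phi> y) \<in> {1, -1}" "s z * s (\<phi> z) \<in> {1, -1}"
      using skD(6) y z by auto
    ultimately have "s y * s (\<phi> y) = s z * s (\<phi> z)" by auto
    with step.IH show ?case by simp
  qed simp
qed

lemma skew_involution_switching_block_form:
  fixes \<Gamma> :: "'a signed_graph"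
  assumes conn: "connected_graph (fst \<Gamma>)" and \<Gamma>: "signed_graph \<Gamma>" and skew: "skew_involution \<Gamma> \<phi> s"
  shows "\<exists>\<Gamma>' :: 'a signed_graph. signed_graph \<Gamma>' \<and> (block_form 1 \<Gamma>' \<or> block_form (-1) \<Gamma>') \<and> \<Gamma> \<simeq>\<^sub>s \<Gamma>'"
proof -
  let ?V = "verts (fst \<Gamma>)"
  note skD = skew_involutionD[OF skew]
  obtain r where r: "r \<in> ?V" using conn by (auto simp: connected_graph_def)
  have const: "s v * s (\<phi> v) = s r * s (\<phi> r)" if "v \<in> ?V" for v
    using skew_involution_constant[OF conn \<Gamma> skew that r] .
  have "s r * s (\<phi> r) \<in> {1, -1}" using skD(6)[OF r] .
  then consider "s r * s (\<phi> r) = -1" | "s r * s (\<phi> r) = 1" by blast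
  then show ?thesis
  proof cases
    case 1
    have opp: "s (\<phi> v) = - s v" if "v \<in> ?V" for v
      using const[OF that] skD(4)[OF that] 1 by auto
    \<comment> \<open>As \<open>s\<close> changes sign along each orbit, its positive vertices
      already form a transversal with \<open>s (\<phi> v) = -1\<close>, so
      \<open>\<delta> = 1\<close> works for \<open>\<Gamma>\<close> itself.\<close>
    define R where "R = {v \<in> ?V. s v = 1}"
    have "v \<in> R \<union> \<phi> ` R" if "v \<in> ?V" for v
    proof (cases "s v = 1")
      case False
      then have "\<phi> v \<in> R" using skD(1,4)[OF that] opp[OF that] by (auto simp: R_def)
      then show ?thesis using skD(2)[OF that] by (auto intro: rev_image_eqI)
    qed (use that in \<open>simp add: R_def\<close>)
    then have "R \<union> \<phi> ` R = ?V" using skD(1) by (auto simp: R_def)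
    moreover have "R \<inter> \<phi> ` R = {}" using opp by (auto simp: R_def)
    ultimately have "block_form 1 \<Gamma>"
      using opp by (intro skew_involution_imp_block_form[OF \<Gamma> skew]) (auto simp: R_def)
    moreover have "\<Gamma> \<simeq>\<^sub>s \<Gamma>"
      by (rule switching_isomorphicI[OF \<Gamma> \<Gamma>, of id "\<lambda>_. 1"]) auto
    ultimately show ?thesis using \<Gamma> by blast
  next
    case 2
    have inv: "s (\<phi> v) = s v" if "v \<in> ?V" for v
      using const[OF that] skD(4)[OF that] 2 by auto
    have "finite ?V" using \<Gamma> by (simp add: signed_graph_def simple_graph_def)
    then obtain R where R: "R \<inter> \<phi> ` R = {}" "R \<union> \<phi> ` R = ?V"
      by (rule involution_transversal[of ?V \<phi>]) (simp_all add: skD(1-3))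
    \<comment> \<open>Here \<open>s\<close> is constant on orbits. Switching at exactly one vertex
      of each orbit with value -1 absorbs \<open>s\<close>, so that the signing becomes constantly
      1, as \<open>\<delta> = -1\<close> demands.\<close>
    define U where "U = {v \<in> \<phi> ` R. s v = -1}"
    define t where "t v = (if v \<in> U then -1 else 1 :: int)" for v
    let ?\<Gamma>' = "switch U \<Gamma>"
    have \<Gamma>': "signed_graph ?\<Gamma>'" using \<Gamma> by (rule signed_graph_switch)
    have adj': "adj ?\<Gamma>' u v = t u * t v * adj \<Gamma> u v" if "u \<in> ?V" "v \<in> ?V" for u v
      using that by (simp add: adj_switch t_def)
    \<comment> \<open>The new vertex signing is \<open>t v * t (\<phi> v) * s v\<close>; this
      identity turns it into a product of squares.\<close>
    have tt: "t (\<phi> v) = t v * s v" if v: "v \<in> ?V" for v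
    proof (cases "v \<in> R")
      case True
      then have "v \<notin> U" using R by (auto simp: U_def)
      then show ?thesis using True skD(4)[OF v] inv[OF v] by (auto simp: t_def U_def)
    next
      case False
      then obtain w where w: "w \<in> R" "v = \<phi> w" using R(2) v by blast
      then have "w \<in> ?V" using R(2) by blast
      then have "\<phi> v = w" using w skD(2) by simp
      moreover have "w \<notin> U" using R w by (auto simp: U_def)
      ultimately show ?thesis using w skD(4)[OF v] by (auto simp: t_def U_def)
    qed
    have "adj ?\<Gamma>' (\<phi> u) (\<phi> v) = - adj ?\<Gamma>' u v" if "u \<in> ?V" "v \<in> ?V" for u v
      using that skD(4)[of u] skD(4)[of v] by (auto simp: adj' skD(1,5) tt)
    then have "skew_involution ?\<Gamma>' \<phi> (\<lambda>_. 1)"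
      using skD(1-3) by (simp add: skew_involution_def)
    then have "block_form (-1) ?\<Gamma>'"
      using skew_involution_imp_block_form[OF \<Gamma>'] R by simp
    moreover have "\<Gamma> \<simeq>\<^sub>s ?\<Gamma>'"
      by (rule switching_isomorphicI[OF \<Gamma> \<Gamma>', of id t]) (auto simp: adj_switch t_def)
    ultimately show ?thesis using \<Gamma>' by blast
  qed
qed

theorem theorem4p1:
  fixes G :: "'a graph" and \<sigma> :: "'a set \<Rightarrow> int"
  assumes "simple_graph G" and "connected_graph G" and "\<not> bipartite_graph G"
    and "signed_graph (G, \<sigma>)"
  shows "(G, \<sigma>) \<in> NFS1 G \<longleftrightarrow>
    (\<exists>\<Gamma>\<^sub>a :: 'a signed_graph. signed_graph \<Gamma>\<^sub>a \<and> has_form_a \<Gamma>\<^sub>a \<and> (G, \<sigma>) \<simeq>\<^sub>s \<Gamma>\<^sub>a) \<or>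
    (\<exists>\<Gamma>\<^sub>b :: 'a signed_graph. signed_graph \<Gamma>\<^sub>b \<and> has_form_b \<Gamma>\<^sub>b \<and> (G, \<sigma>) \<simeq>\<^sub>s \<Gamma>\<^sub>b)"
  (is "?L \<longleftrightarrow> ?R")
proof
  assume ?L
  then obtain \<phi> s where "skew_involution (G, \<sigma>) \<phi> s"
    using NFS1_imp_skew_involution assms(2) by blast
  then show ?R
    using skew_involution_switching_block_form[of "(G, \<sigma>)"] assms(2,4)
    unfolding has_form_a_iff has_form_b_iff fst_conv by blast
next
  assume ?R
  \<comment> \<open>The two forms are merged by \<open>\<delta>\<close>; the exchange of halves in
    \<open>\<Gamma>'\<close> is then pulled back along the switching isomorphism.\<close>
  then obtain \<Gamma>' :: "'a signed_graph" and \<delta> :: int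
    where "block_form \<delta> \<Gamma>'" "\<delta> \<in> {1, -1}" and iso: "(G, \<sigma>) \<simeq>\<^sub>s \<Gamma>'"
    unfolding has_form_a_iff has_form_b_iff by blast
  then obtain \<phi> s where "skew_involution \<Gamma>' \<phi> s" using block_form_imp_skew_involution by blast
  then obtain \<psi> r where "skew_involution (G, \<sigma>) \<psi> r" using skew_involution_transfer[OF iso] by blast
  then show ?L using skew_involution_imp_NFS1 assms(2-4) by blast
qed

end
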